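(* Let $R$ be a finite commutative principal ideal ring with identity, and let $\Psi$ be a subgroup of the group $\mathrm{Aut}(R)$ of ring automorphisms of $R$. Then $$\mathrm{I}_{\Psi}(\mathcal{S}_R)\ \geq\ \mathrm{D}_{\Psi}(\mathrm{U}(R))+\sum_{P\in \mathrm{Spec}(R)} \frac{\mathrm{T}\!\left(\mathrm{Ind}(P);\ \frac{|\Psi|}{|\mathrm{St}(P)|}\right)}{\frac{|\Psi|}{|\mathrm{St}(P)|}}.$$
   Context: Sequences over a set $A$ are finite unordered lists of elements of $A$ with repetition allowed; a subsequence is a sub-multiset; its length counts multiplicity. An idempotent of $R$ is $e\in R$ with $e^2=e$. $\mathcal{S}_R$ is the multiplicative semigroup of $R$ and $\mathrm{U}(R)$ its group of units; each $\psi\in\Psi$ restricts to an automorphism of $\mathrm{U}(R)$. $\mathrm{I}_{\Psi}(\mathcal{S}_R)$ is the least $\ell\in\mathbb{N}\cup\{\infty\}$ such that every sequence over $R$ of length at least $\ell$ contains a nonempty subsequence $a_1,\dots,a_r$ for which there exist $\psi_1,\dots,\psi_r\in\Psi$ (not necessarily distinct) with $\prod_{i=1}^r\psi_i(a_i)$ an idempotent of $R$. $\mathrm{D}_{\Psi}(\mathrm{U}(R))$ is the least positive integer $\ell$ such that every sequence over $\mathrm{U}(R)$ of length at least $\ell$ contains a nonempty subsequence $a_1,\dots,a_r$ for which there exist $\psi_1,\dots,\psi_r\in\Psi$ with $\prod_{i=1}^r\psi_i(a_i)=1_R$. $\mathrm{Spec}(R)$ is the set of prime ideals of $R$. For a prime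 ideal $P$, $\mathrm{Ind}(P)$ is the least integer $t>0$ such that $P^t=P^{t+1}$, and $\mathrm{St}(P)=\{\psi\in\Psi:\psi(P)=P\}$ is its stabilizer. For positive integers $m,h$, $\mathrm{T}(m;h)$ is the maximum of $\sum_{i=1}^h t_i$ over all nonnegative integers $t_1,\dots,t_h$ satisfying $\sum_{i=1}^d i\,t_i<d\,m$ for every $d=1,2,\dots,h$. *)

theory Defs
  imports
    "HOL-Algebra.Bij"
    "HOL-Algebra.QuotRing"
    "HOL-Algebra.Ideal_Product"
    "HOL-Algebra.FiniteProduct"
    "HOL-Library.Multiset"
    "HOL-Library.Extended_Real"
begin

definition principal_ideal_ring :: "('a, 'b) ring_scheme \<Rightarrow> bool" where
  "principal_ideal_ring R \<longleftrightarrow> cring R \<and> (\<forall>I. ideal I R \<longrightarrow> principalideal I R)"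

text \<open>As for \<^const>\<open>AutoGroup\<close>, automorphisms are taken to be extensional on the carrier,
  so that each of them is represented by exactly one function and \<^const>\<open>card\<close> counts
  automorphisms.\<close>

definition ring_auto :: "('a, 'b) ring_scheme \<Rightarrow> ('a \<Rightarrow> 'a) set" where
  "ring_auto R = ring_iso R R \<inter> Bij (carrier R)"

definition Ring_AutoGroup :: "('a, 'b) ring_scheme \<Rightarrow> ('a \<Rightarrow> 'a) monoid" where
  "Ring_AutoGroup R = BijGroup (carrier R) \<lparr>carrier := ring_auto R\<rparr>"

text \<open>Unordered sequences are multisets. A multiset is listed in some order so that equal
  terms can receive different automorphisms.\<close>

definition twisted_products ::
    "('a, 'b) monoid_scheme \<Rightarrow> ('a \<Rightarrow> 'a) set \<Rightarrow> 'a multiset \<Rightarrow> 'a set" where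
  "twisted_products G \<Psi> M =
    {(\<Otimes>\<^bsub>G\<^esub>i\<in>{..<length as}. \<psi> i (as ! i)) | as \<psi>.
        mset as = M \<and> (\<forall>i<length as. \<psi> i \<in> \<Psi>)}"

text \<open>The value is \<open>\<infinity>\<close> if no natural number has the property, since the infimum of
  the empty set in \<^typ>\<open>enat\<close> is \<open>\<infinity>\<close>.\<close>

definition I_const :: "('a, 'b) monoid_scheme \<Rightarrow> ('a \<Rightarrow> 'a) set \<Rightarrow> enat" where
  "I_const G \<Psi> = Inf {enat l | l.
     \<forall>S. set_mset S \<subseteq> carrier G \<and> l \<le> size S \<longrightarrow>
       (\<exists>T. T \<subseteq># S \<and> T \<noteq> {#} \<and> (\<exists>e\<in>twisted_products G \<Psi> T. e \<otimes>\<^bsub>G\<^esub> e = e))}"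

definition D_const :: "('a, 'b) monoid_scheme \<Rightarrow> ('a \<Rightarrow> 'a) set \<Rightarrow> nat" where
  "D_const G \<Psi> = (LEAST l. 0 < l \<and>
     (\<forall>S. set_mset S \<subseteq> carrier G \<and> l \<le> size S \<longrightarrow>
       (\<exists>T. T \<subseteq># S \<and> T \<noteq> {#} \<and> \<one>\<^bsub>G\<^esub> \<in> twisted_products G \<Psi> T)))"

definition Spec :: "('a, 'b) ring_scheme \<Rightarrow> 'a set set" where
  "Spec R = {P. primeideal P R}"

definition Ind :: "('a, 'b) ring_scheme \<Rightarrow> 'a set \<Rightarrow> nat" where
  "Ind R P = (LEAST t::nat. 0 < t \<and>
     P [^]\<^bsub>ideals_set R\<^esub> t = P [^]\<^bsub>ideals_set R\<^esub> (t + 1))"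

definition St :: "('a \<Rightarrow> 'a) set \<Rightarrow> 'a set \<Rightarrow> ('a \<Rightarrow> 'a) set" where
  "St \<Psi> P = {\<psi> \<in> \<Psi>. \<psi> ` P = P}"

text \<open>Division of naturals loses nothing here: the stabilizer is a subgroup of \<open>\<Psi>\<close>.\<close>

definition St_index :: "('a \<Rightarrow> 'a) set \<Rightarrow> 'a set \<Rightarrow> nat" where
  "St_index \<Psi> P = card \<Psi> div card (St \<Psi> P)"

definition T_max :: "nat \<Rightarrow> nat \<Rightarrow> nat" where
  "T_max m h = Max {(\<Sum>i=1..h. t i) | t :: nat \<Rightarrow> nat.
     \<forall>d\<in>{1..h}. (\<Sum>i=1..d. i * t i) < d * m}"

end

theory Submission
  imports Defs "HOL-Algebra.Divisibility"
begin

text \<open>Take a longest sequence of units without a twisted subproduct \<open>1\<close>, and for every orbit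
  \<open>P\<^sub>1, \<dots>, P\<^sub>h\<close> of primes with generators \<open>p\<^sub>1, \<dots>, p\<^sub>h\<close> add \<open>t\<^sub>i\<close> copies of \<open>p\<^sub>1 \<cdots> p\<^sub>i\<close>, where \<open>t\<close>
  attains the maximum in \<open>T(Ind P; h)\<close>. At a prime \<open>P\<close> an idempotent is locally \<open>0\<close> or \<open>1\<close>, so a
  product of such elements is idempotent only if its multiplicity at \<open>P\<close> is \<open>0\<close> or at least
  \<open>Ind P\<close>. If \<open>d > 0\<close> primes of an orbit had positive multiplicity, the total multiplicity over
  the orbit would be at least \<open>d * Ind P\<close>. Only terms of type \<open>i \<le> d\<close> can occur, however, and these
  contribute at most \<open>t\<^sub>1 + 2 t\<^sub>2 + \<dots> + d t\<^sub>d < d * Ind P\<close>. Hence only units occur, and an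
  idempotent unit is \<open>1\<close>. Finally, \<open>|\<Psi>| / |St(P)|\<close> is the size of the orbit of \<open>P\<close>, so the sum over
  \<open>Spec R\<close> in the theorem counts \<open>T\<close> once per orbit.\<close>

section \<open>Products of units, sums over multisets, and witnesses for the extremal
  constants\<close>

text \<open>Lets a twisted product formed in \<open>R\<close> be read in \<open>units_of R\<close>,
  the monoid to which \<open>D_const\<close> refers.\<close>

lemma finprod_units_of:
  assumes "comm_monoid G" "finite A" "\<And>i. i \<in> A \<Longrightarrow> f i \<in> Units G"
  shows "finprod (units_of G) f A = finprod G f A"
  using assms(2,3)
proof (induction A rule: finite_induct)
  case empty
  interpret U: comm_monoid "units_of G"
    using assms(1) comm_monoid.units_comm_group comm_group.axioms(1) by blast
  interpret comm_monoid G by fact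
  show ?case by (simp add: units_of_one)
next
  case (insert i A)
  interpret U: comm_monoid "units_of G"
    using assms(1) comm_monoid.units_comm_group comm_group.axioms(1) by blast
  interpret comm_monoid G by fact
  have f: "f \<in> A \<rightarrow> Units G" "f i \<in> Units G" using insert by auto
  then have "f \<in> A \<rightarrow> carrier G" "f i \<in> carrier G" using Units_closed by auto
  then show ?case
    using f insert U.finprod_insert[of A i f] finprod_insert[of A i f]
    by (simp add: units_of_carrier units_of_mult)
qed

lemma sum_mset_image_sum:
  assumes "finite A"
  shows "(\<Sum>x\<in># (\<Sum>a\<in>A. M a). g x) = (\<Sum>a\<in>A. \<Sum>x\<in># M a. g x)"
  using assms by (induction A rule: finite_induct) auto

lemma sum_mset_subset_mono:
  fixes g :: "'a \<Rightarrow> nat"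
  assumes "T \<subseteq># S"
  shows "(\<Sum>x\<in>#T. g x) \<le> (\<Sum>x\<in>#S. g x)"
proof -
  have "S = T + (S - T)" using assms by simp
  then have "(\<Sum>x\<in>#S. g x) = (\<Sum>x\<in>#T. g x) + (\<Sum>x\<in>#S - T. g x)"
    by (metis image_mset_union sum_mset.union)
  then show ?thesis by simp
qed

text \<open>\<open>Max\<close> is meaningful here: t = 0 is admissible because \<open>0 < m\<close>,
  and for positive \<open>h\<close> the constraint at d = h bounds the sum by \<open>h * m\<close>,
  since every weight i is at least 1.\<close>

lemma T_max_attained:
  assumes "0 < m"
  obtains t where "\<And>d. d \<in> {1..h} \<Longrightarrow> (\<Sum>i=1..d. i * t i) < d * m"
    "(\<Sum>i=1..h. t i) = T_max m h"
proof -
  let ?A = "{(\<Sum>i=1..h. t i) | t :: nat \<Rightarrow> nat. \<forall>d\<in>{1..h}. (\<Sum>i=1..d. i * t i) < d * m}"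
  have "?A \<subseteq> {..h * m}"
  proof
    fix n assume "n \<in> ?A"
    then obtain t where t: "n = (\<Sum>i=1..h. t i)"
      "\<And>d. d \<in> {1..h} \<Longrightarrow> (\<Sum>i=1..d. i * t i) < d * m" by blast
    show "n \<in> {..h * m}"
    proof (cases "h = 0")
      case False
      have "n \<le> (\<Sum>i=1..h. i * t i)" unfolding t(1) by (intro sum_mono) auto
      also have "\<dots> < h * m" using False by (intro t(2)) auto
      finally show ?thesis by simp
    qed (use t in simp)
  qed
  then have "finite ?A" by (rule finite_subset) simp
  moreover have "(\<Sum>i=1..h. 0) \<in> ?A"
    using assms by (intro CollectI exI[of _ "\<lambda>_. 0"]) auto
  ultimately have "Max ?A \<in> ?A" by (intro Max_in) blast+
  then obtain t where "Max ?A = (\<Sum>i=1..h. t i)"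
    "\<forall>d\<in>{1..h}. (\<Sum>i=1..d. i * t i) < d * m" by blast
  then show ?thesis using that[of t] unfolding T_max_def by simp
qed

text \<open>The number just below a \<open>LEAST\<close> fails the defining property, and a sequence
  on which it fails is the witness. That number must be positive for the failure to lie in the
  second conjunct; otherwise the empty sequence serves.\<close>

lemma D_const_witness:
  obtains U where "set_mset U \<subseteq> carrier G" "D_const G \<Psi> \<le> size U + 1"
    "\<And>T. T \<subseteq># U \<Longrightarrow> T \<noteq> {#} \<Longrightarrow> \<one>\<^bsub>G\<^esub> \<notin> twisted_products G \<Psi> T"
proof (cases "D_const G \<Psi> \<le> 1")
  case True
  then show ?thesis using that[of "{#}"] by auto
next
  case False
  let ?Q = "\<lambda>l. 0 < l \<and> (\<forall>S. set_mset S \<subseteq> carrier G \<and> l \<le> size S \<longrightarrow>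
       (\<exists>T. T \<subseteq># S \<and> T \<noteq> {#} \<and> \<one>\<^bsub>G\<^esub> \<in> twisted_products G \<Psi> T))"
  have "D_const G \<Psi> - 1 < (LEAST l. ?Q l)"
    using False unfolding D_const_def by linarith
  then have "\<not> ?Q (D_const G \<Psi> - 1)" by (rule not_less_Least)
  moreover have "0 < D_const G \<Psi> - 1" using False by simp
  ultimately obtain U where "set_mset U \<subseteq> carrier G" "D_const G \<Psi> - 1 \<le> size U"
    "\<not> (\<exists>T. T \<subseteq># U \<and> T \<noteq> {#} \<and> \<one>\<^bsub>G\<^esub> \<in> twisted_products G \<Psi> T)"
    by blast
  moreover from this have "D_const G \<Psi> \<le> size U + 1" by linarith
  ultimately show ?thesis using that[of U] by blast
qed

text \<open>The sequence \<open>S\<close> refutes every candidate length up to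
  \<open>size S\<close>, so each member of the set under the infimum is larger.\<close>

lemma I_const_gt:
  assumes "set_mset S \<subseteq> carrier G"
    and "\<And>T e. T \<subseteq># S \<Longrightarrow> T \<noteq> {#} \<Longrightarrow> e \<in> twisted_products G \<Psi> T \<Longrightarrow> e \<otimes>\<^bsub>G\<^esub> e \<noteq> e"
  shows "enat (size S + 1) \<le> I_const G \<Psi>"
  unfolding I_const_def
proof (rule Inf_greatest)
  fix x assume "x \<in> {enat l | l.
     \<forall>S. set_mset S \<subseteq> carrier G \<and> l \<le> size S \<longrightarrow>
       (\<exists>T. T \<subseteq># S \<and> T \<noteq> {#} \<and> (\<exists>e\<in>twisted_products G \<Psi> T. e \<otimes>\<^bsub>G\<^esub> e = e))}"
  then obtain l where l: "x = enat l" "\<And>S. set_mset S \<subseteq> carrier G \<Longrightarrow> l \<le> size S \<Longrightarrow>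
       \<exists>T. T \<subseteq># S \<and> T \<noteq> {#} \<and> (\<exists>e\<in>twisted_products G \<Psi> T. e \<otimes>\<^bsub>G\<^esub> e = e)" by blast
  have "\<not> l \<le> size S"
    using l(2)[OF assms(1)] assms(2) by blast
  then show "enat (size S + 1) \<le> x" using l(1) by simp
qed

section \<open>Principal ideals, their powers and the index\<close>

locale finite_pir = cring R for R (structure) +
  assumes finite_carrier: "finite (carrier R)"
    and principal: "ideal I R \<Longrightarrow> \<exists>p\<in>carrier R. I = PIdl p"
begin

lemma mem_cgenideal_iff: "x \<in> PIdl p \<longleftrightarrow> (\<exists>c\<in>carrier R. x = c \<otimes> p)"
  by (auto simp: cgenideal_def)

lemma cgenideal_subset_iff:
  assumes "p \<in> carrier R" "q \<in> carrier R"
  shows "PIdl p \<subseteq> PIdl q \<longleftrightarrow> p \<in> PIdl q"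
  using assms cgenideal_minimal[OF cgenideal_ideal] cgenideal_self by blast

lemma divides_iff_mem_cgenideal:
  assumes "p \<in> carrier R"
  shows "p divides x \<longleftrightarrow> x \<in> PIdl p"
  using assms by (auto simp: factor_def mem_cgenideal_iff m_comm)

lemma ideal_prod_cgenideal:
  assumes "a \<in> carrier R" "b \<in> carrier R"
  shows "ideal_prod R (PIdl a) (PIdl b) = PIdl (a \<otimes> b)"
proof
  have "x \<in> PIdl (a \<otimes> b)" if "x \<in> ideal_prod R (PIdl a) (PIdl b)" for x
    using that
  proof (induction rule: ideal_prod.induct)
    case (prod i j)
    then show ?case
      using assms cgenideal_prod[of a b] by (auto simp: set_mult_def)
  next
    case (sum s t)
    then show ?case
      using assms cgenideal_ideal[of "a \<otimes> b"]
      by (meson additive_subgroup.a_closed ideal.axioms(1) m_closed)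
  qed
  then show "ideal_prod R (PIdl a) (PIdl b) \<subseteq> PIdl (a \<otimes> b)"
    by blast
  show "PIdl (a \<otimes> b) \<subseteq> ideal_prod R (PIdl a) (PIdl b)"
    using assms
    by (intro cgenideal_minimal ideal_prod_is_ideal cgenideal_ideal ideal_prod.prod cgenideal_self)
qed

text \<open>Turns the ideal powers in \<open>Ind\<close> into powers of a single generator.\<close>

lemma ideals_set_pow_cgenideal:
  assumes "p \<in> carrier R"
  shows "PIdl p [^]\<^bsub>ideals_set R\<^esub> (n::nat) = PIdl (p [^] n)"
proof (induction n)
  case 0
  have "PIdl \<one> = carrier R"
    by (auto simp: mem_cgenideal_iff)
  then show ?case
    by (simp add: nat_pow_def ideals_set_def)
next
  case (Suc n)
  have "PIdl p [^]\<^bsub>ideals_set R\<^esub> Suc n = PIdl p [^]\<^bsub>ideals_set R\<^esub> n \<otimes>\<^bsub>ideals_set R\<^esub> PIdl p"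
    by (simp add: nat_pow_def)
  also have "\<dots> = ideal_prod R (PIdl (p [^] n)) (PIdl p)"
    unfolding Suc by (simp add: ideals_set_def)
  also have "\<dots> = PIdl (p [^] Suc n)"
    using assms ideal_prod_cgenideal by simp
  finally show ?case .
qed

text \<open>Pigeonhole on the exponents from 1 on; \<open>0 < i\<close> is what the condition
  \<open>0 < t\<close> in \<open>Ind\<close> asks for.\<close>

lemma pow_pigeonhole:
  assumes "x \<in> carrier R"
  obtains i k :: nat where "0 < i" "0 < k" "x [^] i = x [^] (i + k)"
proof -
  have "\<not> inj_on (\<lambda>n::nat. x [^] n) {1..}"
  proof
    assume "inj_on (\<lambda>n::nat. x [^] n) {1..}"
    moreover have "finite ((\<lambda>n::nat. x [^] n) ` {1..})"
      by (rule finite_subset[OF _ finite_carrier]) (use assms in auto)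
    ultimately show False
      using finite_imageD infinite_Ici by blast
  qed
  then obtain i j :: nat where ij: "1 \<le> i" "1 \<le> j" "i \<noteq> j" "x [^] i = x [^] j"
    by (auto simp: inj_on_def)
  show ?thesis
  proof (cases "i < j")
    case True
    then show ?thesis using ij that[of i "j - i"] by simp
  next
    case False
    then show ?thesis using ij that[of j "i - j"] by simp
  qed
qed

lemma Ind_cgenideal:
  assumes "p \<in> carrier R"
  shows "Ind R (PIdl p) = (LEAST t::nat. 0 < t \<and> PIdl (p [^] t) = PIdl (p [^] (t + 1)))"
  unfolding Ind_def using assms by (simp only: ideals_set_pow_cgenideal)

text \<open>The \<open>LEAST\<close> inherits positivity from its predicate once some exponent
  satisfies it. A repetition p^i = p^(i+k) makes p^i a multiple of p^(i+1), so \<open>i\<close> is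
  such an exponent.\<close>

lemma Ind_pos:
  assumes "ideal P R"
  shows "0 < Ind R P"
proof -
  obtain p where p: "p \<in> carrier R" "P = PIdl p"
    using principal[OF assms] by blast
  obtain i k :: nat where ik: "0 < i" "0 < k" "p [^] i = p [^] (i + k)"
    using pow_pigeonhole[OF p(1)] by blast
  have "p [^] i = p [^] (k - 1) \<otimes> p [^] (i + 1)"
  proof -
    have "k - 1 + (i + 1) = i + k" using ik by simp
    then show ?thesis using ik p by (simp only: nat_pow_mult)
  qed
  moreover have "p [^] (i + 1) = p \<otimes> p [^] i"
    using p by (simp add: m_comm)
  ultimately have "PIdl (p [^] i) = PIdl (p [^] (i + 1))"
    using p by (intro equalityI) (auto simp: cgenideal_subset_iff mem_cgenideal_iff simp del: nat_pow_Suc)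
  then have "0 < i \<and> PIdl (p [^] i) = PIdl (p [^] (i + 1))"
    using ik by simp
  then have "0 < (LEAST t::nat. 0 < t \<and> PIdl (p [^] t) = PIdl (p [^] (t + 1)))"
    by (rule LeastI2) simp
  then show ?thesis
    using p Ind_cgenideal by simp
qed

section \<open>Prime ideals of a finite ring\<close>

text \<open>A finite domain is a field: a repetition s^i = s^(i+k) gives s^i (1 - s^k) = 0, and as
  s^i is outside the prime \<open>P\<close>, the other factor lies in \<open>P\<close>. Then s^(k-1)
  is an inverse of \<open>s\<close> modulo \<open>P\<close>.\<close>

lemma primeideal_inverse_mod:
  assumes "primeideal P R" "s \<in> carrier R" "s \<notin> P"
  obtains t where "t \<in> carrier R" "\<one> \<ominus> s \<otimes> t \<in> P"
proof -
  interpret primeideal P R by fact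
  obtain i k :: nat where ik: "0 < i" "0 < k" "s [^] i = s [^] (i + k)"
    using pow_pigeonhole[OF assms(2)] by blast
  have pow: "s [^] n \<notin> P" for n :: nat
  proof (induction n)
    case 0
    then show ?case using I_notcarr one_imp_carrier by auto
  next
    case (Suc n)
    then show ?case using I_prime[of "s [^] n" s] assms by auto
  qed
  have "s [^] i \<otimes> (\<one> \<ominus> s [^] k) = s [^] i \<ominus> s [^] (i + k)"
    using assms by (simp add: nat_pow_mult[symmetric] minus_eq r_distr r_minus)
  also have "\<dots> = \<zero>"
    using ik assms by (simp add: minus_eq r_neg)
  finally have "\<one> \<ominus> s [^] k \<in> P"
    using I_prime[of "s [^] i" "\<one> \<ominus> s [^] k"] pow assms by auto
  moreover have "s [^] k = s \<otimes> s [^] (k - 1)"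
    using ik assms by (metis Suc_pred' nat_pow_Suc2)
  ultimately show ?thesis
    using that[of "s [^] (k - 1)"] assms by simp
qed

text \<open>An element of \<open>Q\<close> outside \<open>P\<close> would be invertible modulo
  \<open>P\<close>, which forces \<one> into \<open>Q\<close>.\<close>

lemma primeideal_subset_eq:
  assumes "primeideal P R" "primeideal Q R" "P \<subseteq> Q"
  shows "P = Q"
proof (rule ccontr)
  assume "P \<noteq> Q"
  then obtain s where s: "s \<in> Q" "s \<notin> P" using assms by blast
  interpret Q: primeideal Q R by fact
  have sc: "s \<in> carrier R" using s Q.Icarr by blast
  obtain t where t: "t \<in> carrier R" "\<one> \<ominus> s \<otimes> t \<in> P"
    using primeideal_inverse_mod assms s sc by blast
  have "(\<one> \<ominus> s \<otimes> t) \<oplus> s \<otimes> t \<in> Q"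
    using assms t s by (intro Q.a_closed Q.I_r_closed) auto
  also have "(\<one> \<ominus> s \<otimes> t) \<oplus> s \<otimes> t = \<one>"
    using sc t by algebra
  finally show False
    using Q.I_notcarr Q.one_imp_carrier by auto
qed

text \<open>Among the finitely many proper ideals containing \<open>x\<close>, a maximal one is a
  maximal ideal of the ring, hence prime.\<close>

lemma nonunit_in_Spec:
  assumes x: "x \<in> carrier R" "x \<notin> Units R"
  obtains P where "P \<in> Spec R" "x \<in> P"
proof -
  let ?A = "{I. ideal I R \<and> x \<in> I \<and> \<one> \<notin> I}"
  have "\<one> \<notin> PIdl x"
    using x m_comm by (auto simp: mem_cgenideal_iff Units_def)
  then have "PIdl x \<in> ?A"
    using x cgenideal_ideal cgenideal_self by auto
  moreover have "finite ?A"
    by (rule finite_subset[of _ "Pow (carrier R)"])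
      (use finite_carrier in \<open>auto dest: ideal.Icarr\<close>)
  ultimately obtain M where M: "M \<in> ?A" and max: "\<And>N. N \<in> ?A \<Longrightarrow> M \<subseteq> N \<Longrightarrow> N = M"
    using finite_has_maximal[of ?A] by blast
  have "maximalideal M R"
  proof (rule maximalidealI)
    show "ideal M R" using M by simp
    show "carrier R \<noteq> M" using M by auto
    fix J assume "ideal J R" "M \<subseteq> J" "J \<subseteq> carrier R"
    then show "J = M \<or> J = carrier R"
      using max[of J] M ideal.one_imp_carrier by blast
  qed
  then have "primeideal M R"
    by (rule maximalideal_prime)
  then show ?thesis
    using that M by (auto simp: Spec_def)
qed

lemma unit_notin_Spec:
  assumes "x \<in> Units R" "P \<in> Spec R"
  shows "x \<notin> P"
proof
  assume "x \<in> P"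
  interpret primeideal P R using assms by (simp add: Spec_def)
  have "inv x \<otimes> x \<in> P" using \<open>x \<in> P\<close> assms by (intro I_l_closed) auto
  then show False using assms I_notcarr one_imp_carrier by auto
qed

lemma finite_Spec: "finite (Spec R)"
proof (rule finite_subset[of _ "Pow (carrier R)"])
  show "Spec R \<subseteq> Pow (carrier R)"
    by (auto simp: Spec_def primeideal_def dest: ideal.Icarr)
qed (use finite_carrier in simp)

lemma Spec_ideal: "P \<in> Spec R \<Longrightarrow> ideal P R"
  by (simp add: Spec_def primeideal.axioms)

section \<open>Local multiplicities at a prime\<close>

text \<open>In the localisation at \<open>P\<close> the element \<open>x\<close> generates the \<open>n\<close>-th power of the
  maximal ideal. Because this power may be stationary, \<open>n\<close> need not be determined by \<open>x\<close>.\<close>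

definition local_order :: "'a set \<Rightarrow> nat \<Rightarrow> 'a \<Rightarrow> bool" where
  "local_order P n x \<longleftrightarrow> x \<in> carrier R \<and> (\<forall>p\<in>carrier R. P = PIdl p \<longrightarrow>
     p [^] n divides x \<and> (\<exists>s\<in>carrier R - P. x divides s \<otimes> p [^] n))"

lemma local_order_0_iff:
  assumes "P \<in> Spec R" "x \<in> carrier R"
  shows "local_order P 0 x \<longleftrightarrow> x \<notin> P"
proof
  interpret ideal P R using Spec_ideal assms by simp
  obtain p where "p \<in> carrier R" "P = PIdl p" using principal is_ideal by blast
  moreover assume "local_order P 0 x"
  ultimately obtain s where "s \<in> carrier R - P" "x divides s"
    by (auto simp: local_order_def)
  then show "x \<notin> P"
    using I_r_closed by (auto simp: factor_def)
next
  assume "x \<notin> P"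
  \<comment> \<open>With exponent 0, \<open>x\<close> itself is the required multiplier outside
    \<open>P\<close>.\<close>
  moreover have "\<one> divides x" "x divides x \<otimes> \<one>"
    using assms l_one r_one by (metis one_closed factor_def)+
  ultimately show "local_order P 0 x"
    using assms by (auto simp: local_order_def)
qed

lemma local_order_1_generator:
  assumes "P \<in> Spec R" "p \<in> carrier R" "P = PIdl p"
  shows "local_order P 1 p"
proof -
  interpret primeideal P R using assms by (simp add: Spec_def)
  have one: "\<one> \<in> carrier R - P"
    using I_notcarr one_imp_carrier by auto
  \<comment> \<open>\<open>local_order\<close> ranges over all generators; two of them divide each
    other, so \<one> serves as the multiplier \<open>s\<close>.\<close>
  have "q divides p \<and> p divides q" if "q \<in> carrier R" "P = PIdl q" for q
    using that assms cgenideal_self by (auto simp: divides_iff_mem_cgenideal)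
  then show ?thesis
    using assms one by (auto simp: local_order_def intro!: bexI[of _ \<one>])
qed

text \<open>The divisibilities multiply, and primality of \<open>P\<close> keeps the product of the
  two multipliers outside \<open>P\<close>.\<close>

lemma local_order_mult:
  assumes P: "P \<in> Spec R" and x: "local_order P m x" and y: "local_order P n y"
  shows "local_order P (m + n) (x \<otimes> y)"
  unfolding local_order_def
proof (intro conjI ballI impI)
  interpret primeideal P R using assms by (simp add: Spec_def)
  have xy: "x \<in> carrier R" "y \<in> carrier R"
    using x y by (auto simp: local_order_def)
  then show "x \<otimes> y \<in> carrier R" by simp
  fix p assume p: "p \<in> carrier R" "P = PIdl p"
  obtain s where s: "s \<in> carrier R" "s \<notin> P" "p [^] m divides x" "x divides s \<otimes> p [^] m"
    using x p by (auto simp: local_order_def)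
  obtain t where t: "t \<in> carrier R" "t \<notin> P" "p [^] n divides y" "y divides t \<otimes> p [^] n"
    using y p by (auto simp: local_order_def)
  have mult: "a \<otimes> c divides b \<otimes> d" if "a divides b" "c divides d"
    "a \<in> carrier R" "b \<in> carrier R" "c \<in> carrier R" "d \<in> carrier R" for a b c d
    using that divides_mult_lI divides_mult_rI divides_trans m_closed by metis
  show "p [^] (m + n) divides x \<otimes> y"
    using mult[OF s(3) t(3)] xy p by (simp add: nat_pow_mult)
  have "x \<otimes> y divides (s \<otimes> t) \<otimes> p [^] (m + n)"
    using mult[OF s(4) t(4)] xy p s t by (simp add: nat_pow_mult[symmetric] m_ac)
  moreover have "s \<otimes> t \<in> carrier R - P"
    using s t I_prime by auto
  ultimately show "\<exists>s\<in>carrier R - P. x \<otimes> y divides s \<otimes> p [^] (m + n)"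
    by blast
qed

text \<open>Up to a factor \<open>s\<close> outside \<open>P\<close>, p^n is a multiple of
  \<open>e\<close> = e^2, hence of p^(2n), and so of p^(n+1) because \<open>0 < n\<close>. Inverting
  \<open>s\<close> modulo \<open>P\<close> removes this factor, so the powers of \<open>P\<close>
  are stationary from \<open>n\<close> on.\<close>

lemma Ind_le_local_order_idempotent:
  assumes P: "P \<in> Spec R" and e: "local_order P n e" "e \<otimes> e = e" and n: "0 < n"
  shows "Ind R P \<le> n"
proof -
  interpret primeideal P R using assms by (simp add: Spec_def)
  obtain p where p: "p \<in> carrier R" "P = PIdl p" using principal is_ideal by blast
  obtain s where s: "s \<in> carrier R" "s \<notin> P" "p [^] n divides e" "e divides s \<otimes> p [^] n"
    using e p by (auto simp: local_order_def)
  have ec: "e \<in> carrier R" using e by (simp add: local_order_def)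
  obtain c where c: "c \<in> carrier R" "e = p [^] n \<otimes> c"
    using s by (auto simp: factor_def)
  obtain d where d: "d \<in> carrier R" "s \<otimes> p [^] n = e \<otimes> d"
    using s by (auto simp: factor_def)
  \<comment> \<open>One factor \<open>p\<close> is split off the second copy of p^n in e^2.\<close>
  have pn: "p [^] n = p \<otimes> p [^] (n - 1)"
    using n p by (metis Suc_pred' nat_pow_Suc2)
  let ?q = "p [^] (n - 1)"
  have q: "?q \<in> carrier R" using p by simp
  have "s \<otimes> p [^] n = (p [^] n \<otimes> c) \<otimes> (p [^] n \<otimes> c) \<otimes> d"
    using d e(2) c by simp
  also have "\<dots> = (p [^] n \<otimes> c) \<otimes> ((p \<otimes> ?q) \<otimes> c) \<otimes> d"
    using pn by simp
  also have "\<dots> = (?q \<otimes> c \<otimes> c \<otimes> d) \<otimes> (p [^] n \<otimes> p)"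
    using p q c d by (simp add: m_ac)
  finally have 1: "s \<otimes> p [^] n = (?q \<otimes> c \<otimes> c \<otimes> d) \<otimes> (p [^] n \<otimes> p)" .
  obtain t where t: "t \<in> carrier R" "\<one> \<ominus> s \<otimes> t \<in> P"
    using primeideal_inverse_mod[OF _ s(1,2)] primeideal by blast
  obtain r where r: "r \<in> carrier R" "\<one> \<ominus> s \<otimes> t = r \<otimes> p"
    using t p by (auto simp: mem_cgenideal_iff)
  \<comment> \<open>Both summands are multiples of p^(n+1): the first by the previous computation,
    the second because 1 - st lies in \<open>P\<close>.\<close>
  have "p [^] n = t \<otimes> (s \<otimes> p [^] n) \<oplus> (\<one> \<ominus> s \<otimes> t) \<otimes> p [^] n"
  proof -
    have "p [^] n \<in> carrier R" using p by simp
    then show ?thesis using s(1) t(1) by algebra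
  qed
  also have "\<dots> = t \<otimes> ((?q \<otimes> c \<otimes> c \<otimes> d) \<otimes> (p [^] n \<otimes> p)) \<oplus> (r \<otimes> p) \<otimes> p [^] n"
    by (simp only: 1 r)
  also have "\<dots> = (t \<otimes> (?q \<otimes> c \<otimes> c \<otimes> d) \<oplus> r) \<otimes> (p [^] n \<otimes> p)"
    using p q c(1) d(1) t(1) r(1) by (simp add: l_distr r_distr m_ac)
  finally have "p [^] n \<in> PIdl (p [^] (n + 1))"
    using p q c d t r by (auto simp: mem_cgenideal_iff)
  moreover have "p [^] (n + 1) \<in> PIdl (p [^] n)"
    using p by (auto simp: mem_cgenideal_iff m_comm)
  ultimately have "PIdl (p [^] n) = PIdl (p [^] (n + 1))"
    using p by (intro equalityI) (auto simp: cgenideal_subset_iff simp del: nat_pow_Suc)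
  then show ?thesis
    using n p by (auto simp: Ind_cgenideal intro: Least_le)
qed

text \<open>The analogue of being squarefree: multiplicity 0 or 1 at every prime. Units and products
  of generators of distinct primes qualify, and for such factors the multiplicity of a product at
  \<open>P\<close> can be taken to be the number of factors in \<open>P\<close>.\<close>

definition simple_at_primes :: "'a \<Rightarrow> bool" where
  "simple_at_primes x \<longleftrightarrow> x \<in> carrier R \<and> (\<forall>P\<in>Spec R. x \<in> P \<longrightarrow> local_order P 1 x)"

lemma local_order_simple:
  assumes "simple_at_primes x" "P \<in> Spec R"
  shows "local_order P (of_bool (x \<in> P)) x"
  using assms local_order_0_iff by (auto simp: simple_at_primes_def)

lemma local_order_finprod:
  assumes "finite A" "P \<in> Spec R" "\<And>i. i \<in> A \<Longrightarrow> simple_at_primes (f i)"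
  shows "local_order P (\<Sum>i\<in>A. of_bool (f i \<in> P)) (finprod R f A)"
  using assms
proof (induction A rule: finite_induct)
  case empty
  interpret primeideal P R using empty by (simp add: Spec_def)
  have "\<one> \<notin> P" using I_notcarr one_imp_carrier by auto
  then show ?case using empty local_order_0_iff by simp
next
  case (insert i A)
  then have "finprod R f (insert i A) = f i \<otimes> finprod R f A"
    by (intro finprod_insert) (auto simp: simple_at_primes_def)
  then show ?case
    using insert local_order_mult[OF insert.prems(1) local_order_simple insert.IH, of "f i"]
    by (simp del: sum_of_bool_eq)
qed

section \<open>Generators of primes and their squarefree products\<close>

definition generator :: "'a set \<Rightarrow> 'a" where
  "generator P = (SOME p. p \<in> carrier R \<and> P = PIdl p)"

lemma generator:
  assumes "P \<in> Spec R"
  shows "generator P \<in> carrier R" "P = PIdl (generator P)"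
  using someI_ex[of "\<lambda>p. p \<in> carrier R \<and> P = PIdl p"] principal[OF Spec_ideal[OF assms]]
  unfolding generator_def by blast+

text \<open>Membership of the generator gives an inclusion of primes, and distinct primes are
  incomparable.\<close>

lemma generator_mem_iff:
  assumes "P \<in> Spec R" "Q \<in> Spec R"
  shows "generator P \<in> Q \<longleftrightarrow> P = Q"
proof
  assume "generator P \<in> Q"
  then have "P \<subseteq> Q"
    using generator[OF assms(1)] cgenideal_minimal[OF Spec_ideal[OF assms(2)]] by metis
  then show "P = Q"
    using assms primeideal_subset_eq by (simp add: Spec_def)
next
  assume "P = Q"
  then show "generator P \<in> Q"
    using generator[OF assms(1)] cgenideal_self by auto
qed

lemma simple_generator: "P \<in> Spec R \<Longrightarrow> simple_at_primes (generator P)"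
  using generator(1) generator_mem_iff local_order_1_generator[OF _ generator]
  by (auto simp: simple_at_primes_def)

definition primes_prod :: "'a set set \<Rightarrow> 'a" where
  "primes_prod F = finprod R generator F"

lemma
  assumes F: "F \<subseteq> Spec R"
  shows simple_primes_prod: "simple_at_primes (primes_prod F)"
    and primes_prod_mem_iff: "P \<in> Spec R \<Longrightarrow> primes_prod F \<in> P \<longleftrightarrow> P \<in> F"
proof -
  have closed: "primes_prod F \<in> carrier R"
    unfolding primes_prod_def using F generator by (intro finprod_closed) auto
  have *: "local_order P (of_bool (P \<in> F)) (primes_prod F)" if P: "P \<in> Spec R" for P
  proof -
    have fin: "finite F" using F finite_Spec finite_subset by blast
    \<comment> \<open>The only factor that can lie in \<open>P\<close> is
      \<open>generator P\<close>, so the multiplicity at \<open>P\<close> is 0 or 1.\<close>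
    have "(\<Sum>Q\<in>F. of_bool (generator Q \<in> P)) = (\<Sum>Q\<in>F. if Q = P then 1 else 0 :: nat)"
      using F P generator_mem_iff by (intro sum.cong) auto
    also have "\<dots> = of_bool (P \<in> F)"
      using fin by simp
    finally show ?thesis
      using local_order_finprod[OF fin P, of generator] F simple_generator
      unfolding primes_prod_def by (metis subsetD)
  qed
  show mem: "primes_prod F \<in> P \<longleftrightarrow> P \<in> F" if "P \<in> Spec R" for P
  proof
    assume "primes_prod F \<in> P"
    then show "P \<in> F"
      using *[OF that] local_order_0_iff[OF that closed] by (cases "P \<in> F") auto
  next
    assume "P \<in> F"
    then have "generator P divides primes_prod F"
      using *[OF that] generator[OF that] by (auto simp: local_order_def)
    then show "primes_prod F \<in> P"
      using generator[OF that] divides_iff_mem_cgenideal by metis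
  qed
  show "simple_at_primes (primes_prod F)"
    unfolding simple_at_primes_def
  proof (intro conjI ballI impI)
    fix P assume "P \<in> Spec R" "primes_prod F \<in> P"
    then show "local_order P 1 (primes_prod F)"
      using *[of P] mem by simp
  qed (rule closed)
qed

end

section \<open>The action of the automorphism group on elements and ideals\<close>

locale finite_pir_autos = finite_pir +
  fixes \<Psi> :: "('a \<Rightarrow> 'a) set"
  assumes autos_subgroup: "subgroup \<Psi> (Ring_AutoGroup R)"
begin

lemma auto_in_ring_auto: "\<psi> \<in> \<Psi> \<Longrightarrow> \<psi> \<in> ring_auto R"
  using subgroup.subset[OF autos_subgroup] by (auto simp: Ring_AutoGroup_def)

lemma auto_ring_iso: "\<psi> \<in> \<Psi> \<Longrightarrow> \<psi> \<in> ring_iso R R"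
  and auto_Bij: "\<psi> \<in> \<Psi> \<Longrightarrow> \<psi> \<in> Bij (carrier R)"
  using auto_in_ring_auto by (auto simp: ring_auto_def)

lemma auto_closed: "\<psi> \<in> \<Psi> \<Longrightarrow> x \<in> carrier R \<Longrightarrow> \<psi> x \<in> carrier R"
  by (rule ring_iso_memE(1)[OF auto_ring_iso])

lemma auto_mult:
  "\<psi> \<in> \<Psi> \<Longrightarrow> x \<in> carrier R \<Longrightarrow> y \<in> carrier R \<Longrightarrow> \<psi> (x \<otimes> y) = \<psi> x \<otimes> \<psi> y"
  by (rule ring_iso_memE(2)[OF auto_ring_iso])

lemma auto_inj: "\<psi> \<in> \<Psi> \<Longrightarrow> inj_on \<psi> (carrier R)"
  and auto_surj: "\<psi> \<in> \<Psi> \<Longrightarrow> \<psi> ` carrier R = carrier R"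
  using auto_Bij by (auto simp: Bij_def bij_betw_def)

lemma finite_autos: "finite \<Psi>"
proof (rule finite_subset)
  show "\<Psi> \<subseteq> carrier R \<rightarrow>\<^sub>E carrier R"
    using auto_Bij Bij_imp_extensional Bij_imp_funcset unfolding PiE_def by blast
qed (use finite_carrier in \<open>simp add: finite_PiE\<close>)

lemma auto_id: "(\<lambda>x\<in>carrier R. x) \<in> \<Psi>"
  using subgroup.one_closed[OF autos_subgroup] by (simp add: Ring_AutoGroup_def BijGroup_def)

lemma auto_compose:
  assumes "\<psi> \<in> \<Psi>" "\<phi> \<in> \<Psi>"
  shows "compose (carrier R) \<psi> \<phi> \<in> \<Psi>"
  using subgroup.m_closed[OF autos_subgroup assms] auto_Bij assms
  by (simp add: Ring_AutoGroup_def BijGroup_def)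

lemma auto_eqI:
  assumes "\<psi> \<in> \<Psi>" "\<phi> \<in> \<Psi>" "\<And>x. x \<in> carrier R \<Longrightarrow> \<psi> x = \<phi> x"
  shows "\<psi> = \<phi>"
  using assms auto_Bij Bij_imp_extensional extensionalityI by metis

lemma inj_on_compose_left:
  assumes "\<psi> \<in> \<Psi>"
  shows "inj_on (compose (carrier R) \<psi>) \<Psi>"
proof (rule inj_onI)
  fix \<phi> \<phi>' assume *: "\<phi> \<in> \<Psi>" "\<phi>' \<in> \<Psi>" "compose (carrier R) \<psi> \<phi> = compose (carrier R) \<psi> \<phi>'"
  have "\<psi> (\<phi> x) = \<psi> (\<phi>' x)" if "x \<in> carrier R" for x
    using *(3) that by (metis compose_eq)
  then show "\<phi> = \<phi>'"
    using * inj_onD[OF auto_inj[OF assms]] auto_closed by (intro auto_eqI) auto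
qed

text \<open>Left composition with \<psi> is an injective self-map of the finite set \<Psi>, so it
  reaches the identity; injectivity of \<psi> makes the right inverse two-sided.\<close>

lemma auto_inverse:
  assumes "\<psi> \<in> \<Psi>"
  obtains \<phi> where "\<phi> \<in> \<Psi>" "\<And>x. x \<in> carrier R \<Longrightarrow> \<psi> (\<phi> x) = x"
    "\<And>x. x \<in> carrier R \<Longrightarrow> \<phi> (\<psi> x) = x"
proof -
  have "compose (carrier R) \<psi> ` \<Psi> = \<Psi>"
    using finite_autos inj_on_compose_left[OF assms] auto_compose[OF assms]
    by (intro endo_inj_surj) auto
  then obtain \<phi> where \<phi>: "\<phi> \<in> \<Psi>" "compose (carrier R) \<psi> \<phi> = (\<lambda>x\<in>carrier R. x)"
    using auto_id by (metis imageE)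
  have 1: "\<psi> (\<phi> x) = x" if "x \<in> carrier R" for x
    using \<phi>(2) that by (metis compose_eq restrict_apply')
  moreover have "\<phi> (\<psi> x) = x" if "x \<in> carrier R" for x
    using 1[of "\<psi> x"] auto_inj[OF assms] assms \<phi> that auto_closed by (metis inj_onD)
  ultimately show ?thesis
    using that \<phi> by blast
qed

lemma compose_image: "P \<subseteq> carrier R \<Longrightarrow> compose (carrier R) \<psi> \<phi> ` P = \<psi> ` \<phi> ` P"
  unfolding image_image by (intro image_cong) (auto simp: compose_def)

lemma Spec_subset: "P \<in> Spec R \<Longrightarrow> P \<subseteq> carrier R"
  using ideal.Icarr[OF Spec_ideal] by (rule subsetI)

lemma auto_inverse_image:
  assumes "\<And>x. x \<in> carrier R \<Longrightarrow> \<phi> (\<psi> x) = x" "P \<subseteq> carrier R"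
  shows "\<phi> ` \<psi> ` P = P"
proof -
  have "\<phi> ` \<psi> ` P = (\<lambda>x. x) ` P"
    unfolding image_image using assms by (intro image_cong) auto
  then show ?thesis by simp
qed

text \<open>The image under \<psi> is the preimage under its inverse, and preimages of primes are
  prime.\<close>

lemma auto_Spec:
  assumes "\<psi> \<in> \<Psi>" "P \<in> Spec R"
  shows "\<psi> ` P \<in> Spec R"
proof -
  obtain \<phi> where \<phi>: "\<phi> \<in> \<Psi>" "\<And>x. x \<in> carrier R \<Longrightarrow> \<psi> (\<phi> x) = x"
    "\<And>x. x \<in> carrier R \<Longrightarrow> \<phi> (\<psi> x) = x"
    by (rule auto_inverse[OF assms(1)]) blast
  have "ring_hom_ring R R \<phi>"
    using auto_ring_iso[OF \<phi>(1)] ring_axioms by (intro ring_hom_ringI2) (simp_all add: ring_iso_def)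
  moreover have "primeideal P R"
    using assms(2) by (simp add: Spec_def)
  ultimately have "primeideal {r \<in> carrier R. \<phi> r \<in> P} R"
    using is_cring ring_hom_ring.primeideal_vimage by blast
  also have "{r \<in> carrier R. \<phi> r \<in> P} = \<psi> ` P"
  proof (intro equalityI subsetI)
    fix r assume "r \<in> {r \<in> carrier R. \<phi> r \<in> P}"
    then show "r \<in> \<psi> ` P"
      using \<phi>(2) by (metis imageI mem_Collect_eq)
  next
    fix r assume "r \<in> \<psi> ` P"
    then show "r \<in> {r \<in> carrier R. \<phi> r \<in> P}"
      using \<phi>(3) Spec_subset[OF assms(2)] auto_closed[OF assms(1)] by auto
  qed
  finally show ?thesis
    by (simp add: Spec_def)
qed

lemma auto_cgenideal:
  assumes "\<psi> \<in> \<Psi>" "p \<in> carrier R"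
  shows "\<psi> ` (PIdl p) = PIdl (\<psi> p)"
proof -
  have "\<psi> ` (PIdl p) = (\<lambda>c. \<psi> c \<otimes> \<psi> p) ` carrier R"
    unfolding cgenideal_def Setcompr_eq_image image_image
    using assms by (intro image_cong) (auto simp: auto_mult)
  also have "\<dots> = (\<lambda>c. c \<otimes> \<psi> p) ` \<psi> ` carrier R"
    by (simp add: image_image)
  also have "\<dots> = PIdl (\<psi> p)"
    unfolding auto_surj[OF assms(1)] by (auto simp: cgenideal_def)
  finally show ?thesis .
qed

lemma auto_pow:
  assumes "\<psi> \<in> \<Psi>" "p \<in> carrier R"
  shows "\<psi> (p [^] (n::nat)) = \<psi> p [^] n"
  using auto_mult[OF assms(1) nat_pow_closed[OF assms(2)] assms(2)]
    ring_iso_memE(4)[OF auto_ring_iso[OF assms(1)]]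
  by (induction n) auto

lemma Ind_image:
  assumes "\<psi> \<in> \<Psi>" "ideal P R"
  shows "Ind R (\<psi> ` P) = Ind R P"
proof -
  obtain p where p: "p \<in> carrier R" "P = PIdl p"
    using principal assms by blast
  \<comment> \<open>The two \<open>LEAST\<close> predicates coincide, as \<psi> is injective on
    ideals.\<close>
  have "PIdl (\<psi> p [^] m) = PIdl (\<psi> p [^] n) \<longleftrightarrow> PIdl (p [^] m) = PIdl (p [^] n)" for m n :: nat
  proof -
    have sub: "PIdl (p [^] k) \<subseteq> carrier R" for k :: nat
      using ideal.Icarr[OF cgenideal_ideal[OF nat_pow_closed[OF p(1)]]] by (rule subsetI)
    have "PIdl (\<psi> p [^] m) = PIdl (\<psi> p [^] n) \<longleftrightarrow> \<psi> ` (PIdl (p [^] m)) = \<psi> ` (PIdl (p [^] n))"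
      using assms p by (simp add: auto_cgenideal auto_pow)
    also have "\<dots> \<longleftrightarrow> PIdl (p [^] m) = PIdl (p [^] n)"
      using inj_on_image_eq_iff[OF auto_inj[OF assms(1)] sub sub] .
    finally show ?thesis .
  qed
  then show ?thesis
    using assms p auto_closed by (simp only: auto_cgenideal Ind_cgenideal)
qed

text \<open>The prime \<open>Q\<close> is pulled back along the inverse \<phi>, the divisibilities
  for \<open>x\<close> are read off there with the generator \<open>\<phi> q\<close>, and \<psi>
  carries them back to \<open>Q\<close>.\<close>

lemma simple_auto:
  assumes "\<psi> \<in> \<Psi>" "simple_at_primes x"
  shows "simple_at_primes (\<psi> x)"
  unfolding simple_at_primes_def
proof (intro conjI ballI impI)
  have x: "x \<in> carrier R" using assms by (simp add: simple_at_primes_def)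
  then show "\<psi> x \<in> carrier R" using assms auto_closed by simp
  fix Q assume Q: "Q \<in> Spec R" "\<psi> x \<in> Q"
  obtain \<phi> where \<phi>: "\<phi> \<in> \<Psi>" "\<And>x. x \<in> carrier R \<Longrightarrow> \<psi> (\<phi> x) = x"
    "\<And>x. x \<in> carrier R \<Longrightarrow> \<phi> (\<psi> x) = x"
    by (rule auto_inverse[OF assms(1)]) blast
  define P where "P = \<phi> ` Q"
  have P: "P \<in> Spec R" using auto_Spec \<phi> Q P_def by simp
  have "x \<in> P" using \<phi>(3)[OF x] Q unfolding P_def by (metis imageI)
  then have ord: "local_order P 1 x"
    using assms P by (simp add: simple_at_primes_def)
  have "q divides \<psi> x \<and> (\<exists>s\<in>carrier R - Q. \<psi> x divides s \<otimes> q)"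
    if q: "q \<in> carrier R" "Q = PIdl q" for q
  proof -
    have \<phi>q: "\<phi> q \<in> carrier R" "P = PIdl (\<phi> q)"
      using q \<phi> auto_closed auto_cgenideal P_def by auto
    then obtain s where s: "s \<in> carrier R" "s \<notin> P" "\<phi> q divides x" "x divides s \<otimes> \<phi> q"
      using ord by (auto simp: local_order_def)
    have "\<psi> (\<phi> q) divides \<psi> x"
      using s(3) \<phi>q(1) auto_mult[OF assms(1)] auto_closed[OF assms(1)] unfolding factor_def by metis
    moreover have "\<psi> x divides \<psi> (s \<otimes> \<phi> q)"
      using s(4) x auto_mult[OF assms(1)] auto_closed[OF assms(1)] unfolding factor_def by metis
    moreover have "\<psi> s \<in> carrier R - Q"
      using s(1,2) \<phi>(3) auto_closed[OF assms(1)] by (metis DiffI P_def imageI)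
    ultimately show ?thesis
      using auto_mult[OF assms(1) s(1) \<phi>q(1)] \<phi>(2)[OF q(1)] by auto
  qed
  then show "local_order Q 1 (\<psi> x)"
    using x assms auto_closed by (auto simp: local_order_def)
qed

section \<open>Orbits of primes and the stabilizer index\<close>

definition orbit :: "'a set \<Rightarrow> 'a set set" where
  "orbit P = (\<lambda>\<psi>. \<psi> ` P) ` \<Psi>"

lemma finite_orbit: "finite (orbit P)"
  using finite_autos by (simp add: orbit_def)

lemma orbit_subset_Spec: "P \<in> Spec R \<Longrightarrow> orbit P \<subseteq> Spec R"
  using auto_Spec by (auto simp: orbit_def)

lemma self_in_orbit: "P \<in> Spec R \<Longrightarrow> P \<in> orbit P"
  using auto_id Spec_subset unfolding orbit_def
  by (intro image_eqI[of _ _ "\<lambda>x\<in>carrier R. x"]) (auto simp: image_iff)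

lemma auto_orbit:
  assumes "P \<in> Spec R" "Q \<in> orbit P" "\<psi> \<in> \<Psi>"
  shows "\<psi> ` Q \<in> orbit P"
proof -
  obtain \<phi> where "\<phi> \<in> \<Psi>" "Q = \<phi> ` P"
    using assms by (auto simp: orbit_def)
  then show ?thesis
    using compose_image[OF Spec_subset[OF assms(1)], of \<psi> \<phi>] auto_compose[OF assms(3)]
    unfolding orbit_def by (metis imageI)
qed

lemma orbit_eq:
  assumes P: "P \<in> Spec R" and Q: "Q \<in> orbit P"
  shows "orbit Q = orbit P"
proof
  show "orbit Q \<subseteq> orbit P"
    using auto_orbit[OF assms] by (auto simp: orbit_def)
  obtain \<psi> where \<psi>: "\<psi> \<in> \<Psi>" "Q = \<psi> ` P" using Q by (auto simp: orbit_def)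
  obtain \<phi> where \<phi>: "\<phi> \<in> \<Psi>" "\<And>x. x \<in> carrier R \<Longrightarrow> \<phi> (\<psi> x) = x"
    by (rule auto_inverse[OF \<psi>(1)]) blast
  have QS: "Q \<in> Spec R" using orbit_subset_Spec assms by blast
  have "P = \<phi> ` Q" using auto_inverse_image[of \<phi> \<psi> P] \<phi> \<psi> Spec_subset[OF P] by simp
  then have "P \<in> orbit Q" using \<phi> by (auto simp: orbit_def)
  then show "orbit P \<subseteq> orbit Q"
    using auto_orbit[OF QS] by (auto simp: orbit_def[of P])
qed

lemma Ind_orbit:
  assumes "P \<in> Spec R" "Q \<in> orbit P"
  shows "Ind R Q = Ind R P"
  using assms Ind_image Spec_ideal by (auto simp: orbit_def)

text \<open>Orbit-stabilizer: the automorphisms taking \<open>P\<close> to a given \<open>Q\<close>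
  in the orbit form a left coset of the stabilizer, so all fibres are equally large. The stabilizer
  is finite and nonempty, hence \<open>div\<close> is exact.\<close>

lemma card_orbit:
  assumes P: "P \<in> Spec R"
  shows "St_index \<Psi> P = card (orbit P)"
proof -
  have Pc: "P \<subseteq> carrier R" using Spec_subset P .
  have fibre: "card {\<psi> \<in> \<Psi>. \<psi> ` P = Q} = card (St \<Psi> P)" if Q: "Q \<in> orbit P" for Q
  proof -
    obtain \<psi> where \<psi>: "\<psi> \<in> \<Psi>" "Q = \<psi> ` P" using Q by (auto simp: orbit_def)
    obtain \<phi> where \<phi>: "\<phi> \<in> \<Psi>" "\<And>x. x \<in> carrier R \<Longrightarrow> \<phi> (\<psi> x) = x"
      "\<And>x. x \<in> carrier R \<Longrightarrow> \<psi> (\<phi> x) = x"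
      by (rule auto_inverse[OF \<psi>(1)]) blast
    have "compose (carrier R) \<psi> ` St \<Psi> P = {\<chi> \<in> \<Psi>. \<chi> ` P = Q}"
    proof (intro equalityI subsetI)
      fix \<chi> assume "\<chi> \<in> compose (carrier R) \<psi> ` St \<Psi> P"
      then obtain \<sigma> where "\<chi> = compose (carrier R) \<psi> \<sigma>" "\<sigma> \<in> \<Psi>" "\<sigma> ` P = P"
        by (auto simp: St_def)
      then show "\<chi> \<in> {\<chi> \<in> \<Psi>. \<chi> ` P = Q}"
        using \<psi> auto_compose compose_image[OF Pc, of \<psi> \<sigma>] by simp
    next
      fix \<chi> assume "\<chi> \<in> {\<chi> \<in> \<Psi>. \<chi> ` P = Q}"
      then have \<chi>: "\<chi> \<in> \<Psi>" "\<chi> ` P = \<psi> ` P" using \<psi> by auto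
      let ?\<sigma> = "compose (carrier R) \<phi> \<chi>"
      have "?\<sigma> ` P = P"
        using \<chi> \<phi> auto_inverse_image[of \<phi> \<psi> P] Pc by (simp add: compose_image)
      then have "?\<sigma> \<in> St \<Psi> P"
        using \<chi> \<phi> auto_compose by (simp add: St_def)
      moreover have "\<chi> = compose (carrier R) \<psi> ?\<sigma>"
        using \<chi> \<phi> \<psi> auto_compose auto_closed by (intro auto_eqI) (simp_all add: compose_eq)
      ultimately show "\<chi> \<in> compose (carrier R) \<psi> ` St \<Psi> P"
        by blast
    qed
    moreover have "inj_on (compose (carrier R) \<psi>) (St \<Psi> P)"
      using inj_on_compose_left[OF \<psi>(1)] by (rule inj_on_subset) (auto simp: St_def)
    ultimately show ?thesis
      using card_image by metis
  qed
  have "card \<Psi> = (\<Sum>Q\<in>orbit P. card {\<psi> \<in> \<Psi>. \<psi> ` P = Q})"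
    unfolding orbit_def card_eq_sum by (rule sum.image_gen[OF finite_autos])
  also have "\<dots> = card (orbit P) * card (St \<Psi> P)"
    using fibre by simp
  finally have "card \<Psi> = card (orbit P) * card (St \<Psi> P)" .
  moreover have "P \<in> orbit P"
    by (rule self_in_orbit[OF P])
  then have "St \<Psi> P \<noteq> {}"
    by (auto simp: orbit_def St_def)
  then have "card (St \<Psi> P) > 0"
    using finite_autos by (simp add: St_def card_gt_0_iff)
  ultimately show ?thesis
    by (simp add: St_index_def)
qed

section \<open>Idempotent twisted products consist of units\<close>

text \<open>On an orbit this is the type of \<open>x\<close>: the product of i distinct primes of
  the orbit has type i.\<close>

definition prime_count :: "'a set set \<Rightarrow> 'a \<Rightarrow> nat" where
  "prime_count X x = card {P \<in> X. x \<in> P}"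

text \<open>\<psi> permutes the orbit and matches the primes containing \<open>x\<close> with those
  containing \<open>\<psi> x\<close>. Twisting therefore leaves the type of a term
  unchanged.\<close>

lemma prime_count_auto:
  assumes P: "P \<in> Spec R" and \<psi>: "\<psi> \<in> \<Psi>" and x: "x \<in> carrier R"
  shows "prime_count (orbit P) (\<psi> x) = prime_count (orbit P) x"
proof -
  obtain \<phi> where \<phi>: "\<phi> \<in> \<Psi>" "\<And>x. x \<in> carrier R \<Longrightarrow> \<phi> (\<psi> x) = x"
    "\<And>x. x \<in> carrier R \<Longrightarrow> \<psi> (\<phi> x) = x"
    by (rule auto_inverse[OF \<psi>(1)]) blast
  have sub: "Q \<subseteq> carrier R" if "Q \<in> orbit P" for Q
    using that orbit_subset_Spec[OF P] Spec_subset by blast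
  have "bij_betw ((`) \<psi>) {Q \<in> orbit P. x \<in> Q} {Q \<in> orbit P. \<psi> x \<in> Q}"
  proof (rule bij_betw_byWitness[where f' = "(`) \<phi>"])
    show "\<forall>Q\<in>{Q \<in> orbit P. x \<in> Q}. \<phi> ` \<psi> ` Q = Q"
      using auto_inverse_image[of \<phi> \<psi>] \<phi> sub by simp
    show "\<forall>Q\<in>{Q \<in> orbit P. \<psi> x \<in> Q}. \<psi> ` \<phi> ` Q = Q"
      using auto_inverse_image[of \<psi> \<phi>] \<phi> sub by simp
    show "(`) \<psi> ` {Q \<in> orbit P. x \<in> Q} \<subseteq> {Q \<in> orbit P. \<psi> x \<in> Q}"
      using auto_orbit[OF P _ \<psi>] by auto
    show "(`) \<phi> ` {Q \<in> orbit P. \<psi> x \<in> Q} \<subseteq> {Q \<in> orbit P. x \<in> Q}"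
    proof
      fix Q assume "Q \<in> (`) \<phi> ` {Q \<in> orbit P. \<psi> x \<in> Q}"
      then obtain Q' where "Q' \<in> orbit P" "\<psi> x \<in> Q'" "Q = \<phi> ` Q'" by auto
      then show "Q \<in> {Q \<in> orbit P. x \<in> Q}"
        using auto_orbit[OF P _ \<phi>(1)] imageI[of "\<psi> x" Q' \<phi>] \<phi>(2)[OF x] by simp
    qed
  qed
  then show ?thesis
    unfolding prime_count_def by (rule bij_betw_same_card[symmetric])
qed

text \<open>\<open>bound\<close> is the inequality defining T, summed over the terms of type at most
  \<open>d\<close>. The conclusion is phrased in \<open>units_of R\<close> so that it contradicts
  the choice of an extremal sequence of units.\<close>

lemma idempotent_twisted_product_units:
  assumes simple: "\<And>x. x \<in># S \<Longrightarrow> simple_at_primes x"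
    and bound: "\<And>P d. P \<in> Spec R \<Longrightarrow> d \<in> {1..card (orbit P)} \<Longrightarrow>
      (\<Sum>x\<in>#S. if prime_count (orbit P) x \<le> d then prime_count (orbit P) x else 0) < d * Ind R P"
    and T: "T \<subseteq># S" and e: "e \<in> twisted_products R \<Psi> T" "e \<otimes> e = e"
  shows "set_mset T \<subseteq> Units R \<and> \<one> \<in> twisted_products (units_of R) \<Psi> T"
proof -
  obtain as \<psi> where as: "mset as = T" and \<psi>: "\<And>i. i < length as \<Longrightarrow> \<psi> i \<in> \<Psi>"
    and e_eq: "e = (\<Otimes>i\<in>{..<length as}. \<psi> i (as ! i))"
    using e(1) unfolding twisted_products_def by blast
  define f where "f i = \<psi> i (as ! i)" for i
  define v where "v P = (\<Sum>i<length as. of_bool (f i \<in> P) :: nat)" for P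
  have as_simple: "simple_at_primes (as ! i)" if "i < length as" for i
    using simple T as that by (metis mset_subset_eqD nth_mem_mset)
  then have f_simple: "simple_at_primes (f i)" if "i < length as" for i
    using simple_auto \<psi> that by (simp add: f_def)
  have as_carrier: "as ! i \<in> carrier R" if "i < length as" for i
    using as_simple that by (simp add: simple_at_primes_def)
  have f_carrier: "f i \<in> carrier R" if "i < length as" for i
    using f_simple that by (simp add: simple_at_primes_def)
  have ord: "local_order P (v P) e" if "P \<in> Spec R" for P
    unfolding e_eq v_def f_def[symmetric] using that f_simple by (intro local_order_finprod) auto
  have v0: "v P = 0" if P: "P \<in> Spec R" for P
  proof (rule ccontr)
    assume "v P \<noteq> 0"
    \<comment> \<open>The primes of the orbit with positive multiplicity in \<open>e\<close>;
      \<open>card D\<close> is the \<open>d\<close> at which \<open>bound\<close> is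
      applied.\<close>
    define D where "D = {Q \<in> orbit P. v Q \<noteq> 0}"
    have D_fin: "finite D" using finite_orbit by (simp add: D_def)
    have "P \<in> D" using \<open>v P \<noteq> 0\<close> self_in_orbit[OF P] by (simp add: D_def)
    then have "card D \<ge> 1" using D_fin by (simp add: Suc_le_eq card_gt_0_iff) blast
    moreover have "card D \<le> card (orbit P)"
      using finite_orbit by (intro card_mono) (auto simp: D_def)
    ultimately have d: "card D \<in> {1..card (orbit P)}" by simp
    have count: "prime_count (orbit P) (f i) = prime_count (orbit P) (as ! i)"
      "prime_count (orbit P) (f i) \<le> card D" if i: "i < length as" for i
    proof -
      show "prime_count (orbit P) (f i) = prime_count (orbit P) (as ! i)"
        unfolding f_def using prime_count_auto[OF P \<psi>[OF i] as_carrier[OF i]] .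
      \<comment> \<open>A twisted term in \<open>Q\<close> makes \<open>v Q\<close> positive, so no
        term of \<open>T\<close> has type above \<open>card D\<close>.\<close>
      have "{Q \<in> orbit P. f i \<in> Q} \<subseteq> D"
        using i by (auto simp: D_def v_def)
      then show "prime_count (orbit P) (f i) \<le> card D"
        unfolding prime_count_def by (intro card_mono D_fin)
    qed
    have "card D * Ind R P = (\<Sum>Q\<in>D. Ind R P)" by simp
    also have "\<dots> \<le> (\<Sum>Q\<in>D. v Q)"
    proof (rule sum_mono)
      fix Q assume "Q \<in> D"
      then have Q: "Q \<in> orbit P" "Q \<in> Spec R" "0 < v Q"
        using orbit_subset_Spec[OF P] by (auto simp: D_def)
      then show "Ind R P \<le> v Q"
        using Ind_le_local_order_idempotent[OF Q(2) ord e(2)] Ind_orbit[OF P Q(1)] by simp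
    qed
    also have "\<dots> = (\<Sum>Q\<in>orbit P. v Q)"
      using finite_orbit by (intro sum.mono_neutral_left) (auto simp: D_def)
    \<comment> \<open>Double counting of incidences between terms and primes: the total multiplicity
      is the sum of the types.\<close>
    also have "\<dots> = (\<Sum>i<length as. \<Sum>Q\<in>orbit P. of_bool (f i \<in> Q))"
      unfolding v_def by (rule sum.swap)
    also have "\<dots> = (\<Sum>i<length as. prime_count (orbit P) (f i))"
      using finite_orbit by (simp add: prime_count_def Int_def)
    \<comment> \<open>The cutoff changes nothing on \<open>T\<close>, but is needed before passing
      to \<open>S\<close>, which may contain terms of larger type.\<close>
    also have "\<dots> = (\<Sum>i<length as. if prime_count (orbit P) (as ! i) \<le> card D
        then prime_count (orbit P) (as ! i) else 0)"
      using count by (intro sum.cong) auto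
    also have "\<dots> = (\<Sum>x\<in>#T. if prime_count (orbit P) x \<le> card D
        then prime_count (orbit P) x else 0)"
      unfolding as[symmetric] mset_map[symmetric] sum_mset_sum_list
      by (simp add: sum_list_sum_nth atLeast0LessThan)
    also have "\<dots> \<le> (\<Sum>x\<in>#S. if prime_count (orbit P) x \<le> card D
        then prime_count (orbit P) x else 0)"
      by (rule sum_mset_subset_mono[OF T])
    also have "\<dots> < card D * Ind R P"
      by (rule bound[OF P d])
    finally show False by simp
  qed
  have f_notin: "f i \<notin> P" if "i < length as" "P \<in> Spec R" for i P
    using v0[OF that(2)] that(1) by (auto simp: v_def)
  have f_units: "f i \<in> Units R" if "i < length as" for i
    using nonunit_in_Spec[OF f_carrier[OF that]] f_notin[OF that] by blast
  \<comment> \<open>If a term lay in \<open>P\<close>, its twist would lie in the image of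
    \<open>P\<close> under \<open>\<psi> i\<close>, which is again a prime.\<close>
  have as_units: "as ! i \<in> Units R" if "i < length as" for i
  proof (rule ccontr)
    assume "as ! i \<notin> Units R"
    then obtain P where "P \<in> Spec R" "as ! i \<in> P"
      using nonunit_in_Spec as_carrier[OF \<open>i < length as\<close>] by blast
    then show False
      using f_notin[OF that auto_Spec[OF \<psi>[OF that]]] by (auto simp: f_def)
  qed
  have e_units: "e \<in> Units R"
  proof (rule ccontr)
    assume "e \<notin> Units R"
    moreover have "e \<in> carrier R"
      unfolding e_eq f_def[symmetric] using f_carrier by (intro finprod_closed) auto
    ultimately obtain P where "P \<in> Spec R" "e \<in> P"
      using nonunit_in_Spec by blast
    then show False
      using ord v0 local_order_0_iff \<open>e \<in> carrier R\<close> by metis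
  qed
  have "e = \<one>"
    using e_units e(2) Units_l_cancel[of e e \<one>] by (simp add: Units_closed)
  then have "\<one> = (\<Otimes>\<^bsub>units_of R\<^esub>i\<in>{..<length as}. \<psi> i (as ! i))"
    unfolding e_eq f_def[symmetric]
    using f_units finprod_units_of[OF comm_monoid_axioms, of "{..<length as}" f] by simp
  then have "\<one> \<in> twisted_products (units_of R) \<Psi> T"
    unfolding twisted_products_def using as \<psi> by blast
  moreover have "set_mset T \<subseteq> Units R"
    using as_units unfolding as[symmetric] by (auto simp: in_set_conv_nth)
  ultimately show ?thesis by simp
qed

section \<open>The extremal sequence for one orbit\<close>

lemma extremal_orbit_multiset:
  assumes P: "P \<in> Spec R"
  obtains M where "size M = T_max (Ind R P) (card (orbit P))"
    "\<And>x. x \<in># M \<Longrightarrow> simple_at_primes x"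
    "\<And>x. x \<in># M \<Longrightarrow> x \<notin> Units R"
    "\<And>x Q. x \<in># M \<Longrightarrow> Q \<in> Spec R \<Longrightarrow> x \<in> Q \<Longrightarrow> Q \<in> orbit P"
    "\<And>d. d \<in> {1..card (orbit P)} \<Longrightarrow>
      (\<Sum>x\<in>#M. if prime_count (orbit P) x \<le> d then prime_count (orbit P) x else 0) < d * Ind R P"
proof -
  let ?h = "card (orbit P)"
  obtain b where b: "bij_betw b {1..?h} (orbit P)"
    using ex_bij_betw_nat_finite_1[OF finite_orbit] by blast
  obtain t where t: "\<And>d. d \<in> {1..?h} \<Longrightarrow> (\<Sum>i=1..d. i * t i) < d * Ind R P"
    "(\<Sum>i=1..?h. t i) = T_max (Ind R P) ?h"
    using T_max_attained[OF Ind_pos[OF Spec_ideal[OF P]], of ?h] by blast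
  \<comment> \<open>The first i primes of the orbit, so that \<open>primes_prod (F i)\<close> has
    type i.\<close>
  define F where "F i = b ` {1..i}" for i
  have F: "F i \<subseteq> orbit P" "F i \<subseteq> Spec R" "card (F i) = i" if "i \<in> {1..?h}" for i
  proof -
    have sub: "{1..i} \<subseteq> {1..?h}" using that by auto
    then show "F i \<subseteq> orbit P" using b by (auto simp: F_def bij_betw_def)
    then show "F i \<subseteq> Spec R" using orbit_subset_Spec[OF P] by blast
    have "inj_on b {1..i}" using b sub by (meson bij_betw_def inj_on_subset)
    then show "card (F i) = i" by (simp add: F_def card_image)
  qed
  define M where "M = (\<Sum>i=1..?h. replicate_mset (t i) (primes_prod (F i)))"
  have M: "\<exists>i\<in>{1..?h}. x = primes_prod (F i)" if "x \<in># M" for x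
    using that by (auto simp: M_def set_mset_sum split: if_splits)
  have count: "prime_count (orbit P) (primes_prod (F i)) = i" if i: "i \<in> {1..?h}" for i
  proof -
    have "{Q \<in> orbit P. primes_prod (F i) \<in> Q} = F i"
      using primes_prod_mem_iff[OF F(2)[OF i]] F(1)[OF i] orbit_subset_Spec[OF P] by blast
    then show ?thesis using F(3)[OF i] by (simp add: prime_count_def)
  qed
  show ?thesis
  proof
    show "size M = T_max (Ind R P) ?h"
      unfolding t(2)[symmetric] M_def size_eq_sum_mset by (simp add: sum_mset_image_sum)
  next
    fix x assume "x \<in># M"
    then obtain i where i: "i \<in> {1..?h}" "x = primes_prod (F i)" using M by blast
    show "simple_at_primes x" using simple_primes_prod[OF F(2)] i by simp
    show "Q \<in> orbit P" if "Q \<in> Spec R" "x \<in> Q" for Q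
      using that i primes_prod_mem_iff[OF F(2)] F(1) by blast
    \<comment> \<open>Types start at 1, so every term lies in some prime and is not a unit.\<close>
    have "F i \<noteq> {}" using F(3)[OF i(1)] i(1) by auto
    then obtain Q where "Q \<in> F i" by blast
    then have Q: "Q \<in> Spec R" "x \<in> Q" using F(2) i primes_prod_mem_iff[OF F(2)] by blast+
    then show "x \<notin> Units R" using unit_notin_Spec by blast
  next
    fix d assume d: "d \<in> {1..?h}"
    have "(\<Sum>x\<in>#M. if prime_count (orbit P) x \<le> d then prime_count (orbit P) x else 0) =
      (\<Sum>i=1..?h. t i * (if i \<le> d then i else 0))"
      unfolding M_def sum_mset_image_sum[OF finite_atLeastAtMost]
      using count by (intro sum.cong) auto
    \<comment> \<open>The cutoff at \<open>d\<close> truncates the sum to exactly the one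
      constrained in \<open>T_max\<close>.\<close>
    also have "\<dots> = (\<Sum>i=1..d. i * t i)"
      using d by (intro sum.mono_neutral_cong_right) auto
    also have "\<dots> < d * Ind R P" by (rule t(1)[OF d])
    finally show "(\<Sum>x\<in>#M. if prime_count (orbit P) x \<le> d then prime_count (orbit P) x else 0) < d * Ind R P" .
  qed
qed

section \<open>Combining the orbits with an extremal sequence of units\<close>

lemma orbits_disjoint:
  assumes "P \<in> Spec R" "P' \<in> Spec R" "Q \<in> orbit P" "Q \<in> orbit P'"
  shows "orbit P = orbit P'"
  using orbit_eq assms by metis

text \<open>The orbits partition \<open>Spec R\<close>, and each \<open>X\<close> receives
  \<open>card X\<close> equal shares of \<open>g X\<close>.\<close>

lemma sum_Spec_orbits:
  fixes f :: "'a set \<Rightarrow> real"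
  assumes "\<And>X P. X \<in> orbit ` Spec R \<Longrightarrow> P \<in> X \<Longrightarrow> f P = g X / card X"
  shows "(\<Sum>P\<in>Spec R. f P) = (\<Sum>X\<in>orbit ` Spec R. g X)"
proof -
  have "(\<Sum>P\<in>Spec R. f P) = (\<Sum>X\<in>orbit ` Spec R. \<Sum>P\<in>{P \<in> Spec R. orbit P = X}. f P)"
    by (rule sum.image_gen[OF finite_Spec])
  also have "\<dots> = (\<Sum>X\<in>orbit ` Spec R. g X)"
  proof (rule sum.cong)
    fix X assume X: "X \<in> orbit ` Spec R"
    then obtain P where P: "P \<in> Spec R" "X = orbit P" by blast
    have "{Q \<in> Spec R. orbit Q = X} = X"
      using P orbit_eq self_in_orbit orbit_subset_Spec by blast
    moreover have "(\<Sum>Q\<in>X. f Q) = (\<Sum>Q\<in>X. g X / card X)"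
      using assms X by (intro sum.cong) auto
    moreover have "card X > 0"
      using P self_in_orbit finite_orbit by (auto simp: card_gt_0_iff)
    ultimately show "(\<Sum>P\<in>{P \<in> Spec R. orbit P = X}. f P) = g X"
      by simp
  qed simp
  finally show ?thesis .
qed

lemma I_const_lower_bound:
  "ereal (real (D_const (units_of R) \<Psi>)
      + (\<Sum>P\<in>Spec R. real (T_max (Ind R P) (St_index \<Psi> P)) / real (St_index \<Psi> P)))
    \<le> ereal_of_enat (I_const R \<Psi>)"
proof -
  let ?K = "orbit ` Spec R"
  let ?c = "\<lambda>X d x. if prime_count X x \<le> d then prime_count X x else 0"
  \<comment> \<open>One sequence is chosen per orbit rather than per prime; its properties hold for
    every \<open>P\<close> in \<open>X\<close> because \<open>Ind\<close> is constant on an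
    orbit.\<close>
  have "\<exists>M. (\<forall>P\<in>X. size M = T_max (Ind R P) (card X)) \<and>
      (\<forall>x\<in>#M. simple_at_primes x \<and> x \<notin> Units R \<and> (\<forall>Q\<in>Spec R. x \<in> Q \<longrightarrow> Q \<in> X)) \<and>
      (\<forall>P\<in>X. \<forall>d\<in>{1..card X}. (\<Sum>x\<in>#M. ?c X d x) < d * Ind R P)" if "X \<in> ?K" for X
  proof -
    obtain P where P: "P \<in> Spec R" "X = orbit P" using \<open>X \<in> ?K\<close> by blast
    have Ind: "Ind R Q = Ind R P" if "Q \<in> X" for Q
      using Ind_orbit P that by blast
    obtain M where "size M = T_max (Ind R P) (card X)"
      "\<And>x. x \<in># M \<Longrightarrow> simple_at_primes x"
      "\<And>x. x \<in># M \<Longrightarrow> x \<notin> Units R"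
      "\<And>x Q. x \<in># M \<Longrightarrow> Q \<in> Spec R \<Longrightarrow> x \<in> Q \<Longrightarrow> Q \<in> X"
      "\<And>d. d \<in> {1..card X} \<Longrightarrow> (\<Sum>x\<in>#M. ?c X d x) < d * Ind R P"
      unfolding P(2) by (rule extremal_orbit_multiset[OF P(1)]) blast
    then show ?thesis
      using Ind by (intro exI[of _ M]) auto
  qed
  then have "\<exists>M. \<forall>X\<in>?K. (\<forall>P\<in>X. size (M X) = T_max (Ind R P) (card X)) \<and>
      (\<forall>x\<in>#M X. simple_at_primes x \<and> x \<notin> Units R \<and> (\<forall>Q\<in>Spec R. x \<in> Q \<longrightarrow> Q \<in> X)) \<and>
      (\<forall>P\<in>X. \<forall>d\<in>{1..card X}. (\<Sum>x\<in>#M X. ?c X d x) < d * Ind R P)"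
    by (intro bchoice ballI)
  then obtain M where M: "\<forall>X\<in>?K. (\<forall>P\<in>X. size (M X) = T_max (Ind R P) (card X)) \<and>
      (\<forall>x\<in>#M X. simple_at_primes x \<and> x \<notin> Units R \<and> (\<forall>Q\<in>Spec R. x \<in> Q \<longrightarrow> Q \<in> X)) \<and>
      (\<forall>P\<in>X. \<forall>d\<in>{1..card X}. (\<Sum>x\<in>#M X. ?c X d x) < d * Ind R P)"
    by (rule exE)
  have M_size: "size (M X) = T_max (Ind R P) (card X)" if "X \<in> ?K" "P \<in> X" for X P
    using M that by blast
  have M_elem: "simple_at_primes x" "x \<notin> Units R" "Q \<in> Spec R \<Longrightarrow> x \<in> Q \<Longrightarrow> Q \<in> X"
    if "X \<in> ?K" "x \<in># M X" for X x Q
    using M that by blast+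
  have M_bound: "(\<Sum>x\<in>#M X. ?c X d x) < d * Ind R P"
    if "X \<in> ?K" "P \<in> X" "d \<in> {1..card X}" for X P d
    using M that by blast
  obtain U where U: "set_mset U \<subseteq> Units R" "D_const (units_of R) \<Psi> \<le> size U + 1"
    "\<And>T. T \<subseteq># U \<Longrightarrow> T \<noteq> {#} \<Longrightarrow> \<one> \<notin> twisted_products (units_of R) \<Psi> T"
    by (rule D_const_witness[of "units_of R" \<Psi>]) (simp add: units_of_carrier units_of_one)
  define S where "S = U + (\<Sum>X\<in>?K. M X)"
  have fin: "finite ?K" using finite_Spec by simp
  have S_cases: "x \<in># U \<or> (\<exists>X\<in>?K. x \<in># M X)" if "x \<in># S" for x
    using that fin by (auto simp: S_def set_mset_sum)
  have simple: "simple_at_primes x" if "x \<in># S" for x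
    using S_cases[OF that] M_elem(1) U(1) unit_notin_Spec by (auto simp: simple_at_primes_def)
  have bound: "(\<Sum>x\<in>#S. ?c (orbit P) d x) < d * Ind R P"
    if P: "P \<in> Spec R" and d: "d \<in> {1..card (orbit P)}" for P d
  proof -
    have U0: "(\<Sum>x\<in>#U. ?c (orbit P) d x) = 0"
    proof -
      have "?c (orbit P) d x = 0" if "x \<in># U" for x
      proof -
        have "{Q \<in> orbit P. x \<in> Q} = {}"
          using that U(1) unit_notin_Spec orbit_subset_Spec[OF P] by blast
        then have "prime_count (orbit P) x = 0"
          unfolding prime_count_def by (simp only: card.empty)
        then show ?thesis by simp
      qed
      then show ?thesis by simp
    qed
    \<comment> \<open>Terms built from another orbit lie in no prime of this one, so the orbits do
      not interfere.\<close>
    have others: "(\<Sum>x\<in>#M X. ?c (orbit P) d x) = 0" if X: "X \<in> ?K - {orbit P}" for X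
    proof -
      have "?c (orbit P) d x = 0" if "x \<in># M X" for x
      proof -
        have "{Q \<in> orbit P. x \<in> Q} = {}"
          using that X P M_elem(3) orbit_subset_Spec[OF P] orbits_disjoint by blast
        then have "prime_count (orbit P) x = 0"
          unfolding prime_count_def by (simp only: card.empty)
        then show ?thesis by simp
      qed
      then show ?thesis by simp
    qed
    have "(\<Sum>X\<in>?K - {orbit P}. \<Sum>x\<in># M X. ?c (orbit P) d x) = 0"
      by (intro sum.neutral ballI others)
    moreover have "(\<Sum>X\<in>?K. \<Sum>x\<in># M X. ?c (orbit P) d x) = (\<Sum>x\<in># M (orbit P). ?c (orbit P) d x)
        + (\<Sum>X\<in>?K - {orbit P}. \<Sum>x\<in># M X. ?c (orbit P) d x)"
      using P by (intro sum.remove fin) auto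
    ultimately have "(\<Sum>x\<in>#S. ?c (orbit P) d x) = (\<Sum>x\<in># M (orbit P). ?c (orbit P) d x)"
      unfolding S_def image_mset_union sum_mset.union sum_mset_image_sum[OF fin] U0 by simp
    also have "\<dots> < d * Ind R P"
      using P d self_in_orbit by (intro M_bound) auto
    finally show ?thesis .
  qed
  \<comment> \<open>The extra 1 absorbs the one in
    \<open>D_const (units_of R) \<Psi> \<le> size U + 1\<close>.\<close>
  have "enat (size S + 1) \<le> I_const R \<Psi>"
  proof (rule I_const_gt)
    show "set_mset S \<subseteq> carrier R"
      using simple by (auto simp: simple_at_primes_def)
    fix T e assume T: "T \<subseteq># S" "T \<noteq> {#}" "e \<in> twisted_products R \<Psi> T"
    show "e \<otimes> e \<noteq> e"
    proof
      assume "e \<otimes> e = e"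
      then have T': "set_mset T \<subseteq> Units R" "\<one> \<in> twisted_products (units_of R) \<Psi> T"
        using idempotent_twisted_product_units[OF simple bound T(1,3)] by auto
      \<comment> \<open>Filtering by units turns inclusion in \<open>S\<close> into inclusion in
        \<open>U\<close> with multiplicities, since all terms of the sequences \<open>M X\<close>
        are nonunits.\<close>
      have "T = filter_mset (\<lambda>x. x \<in> Units R) T"
        using T'(1) by (intro filter_mset_eq_conv[THEN iffD2, symmetric]) auto
      also have "\<dots> \<subseteq># filter_mset (\<lambda>x. x \<in> Units R) S"
        by (rule multiset_filter_mono[OF T(1)])
      also have "\<dots> = U"
      proof -
        have "filter_mset (\<lambda>x. x \<in> Units R) U = U"
          using U(1) by (auto simp: filter_mset_eq_conv)
        moreover have "filter_mset (\<lambda>x. x \<in> Units R) (\<Sum>X\<in>?K. M X) = {#}"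
          using M_elem(2) fin by (auto simp: set_mset_sum)
        ultimately show ?thesis by (simp add: S_def)
      qed
      finally show False using U(3) T(2) T'(2) by blast
    qed
  qed
  then have "ereal_of_enat (enat (size S + 1)) \<le> ereal_of_enat (I_const R \<Psi>)"
    by (simp only: ereal_of_enat_le_iff)
  then have I: "ereal (real (size S + 1)) \<le> ereal_of_enat (I_const R \<Psi>)"
    by simp
  have "(\<Sum>P\<in>Spec R. real (T_max (Ind R P) (St_index \<Psi> P)) / real (St_index \<Psi> P))
      = (\<Sum>X\<in>?K. real (size (M X)))"
  proof (rule sum_Spec_orbits)
    fix X P assume XP: "X \<in> ?K" "P \<in> X"
    then obtain Q where Q: "Q \<in> Spec R" "X = orbit Q" by blast
    then have "P \<in> Spec R" "orbit P = X"
      using XP orbit_subset_Spec[of Q] orbit_eq[of Q P] by auto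
    then show "real (T_max (Ind R P) (St_index \<Psi> P)) / real (St_index \<Psi> P)
        = real (size (M X)) / real (card X)"
      using M_size[OF XP] card_orbit by simp
  qed
  moreover have "size S = size U + (\<Sum>X\<in>?K. size (M X))"
    unfolding S_def size_union size_eq_sum_mset[of "\<Sum>X\<in>?K. M X"] sum_mset_image_sum[OF fin]
    by (simp flip: size_eq_sum_mset)
  ultimately have "real (D_const (units_of R) \<Psi>)
      + (\<Sum>P\<in>Spec R. real (T_max (Ind R P) (St_index \<Psi> P)) / real (St_index \<Psi> P))
      \<le> real (size S + 1)"
    using U(2) by simp
  then show ?thesis
    by (rule order_trans[OF _ I, OF ereal_less_eq(3)[THEN iffD2]])
qed

end

theorem theorem1:
  fixes R :: "('a, 'b) ring_scheme" and \<Psi> :: "('a \<Rightarrow> 'a) set"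
  assumes "principal_ideal_ring R"
    and "finite (carrier R)"
    and "subgroup \<Psi> (Ring_AutoGroup R)"
  shows "ereal_of_enat (I_const R \<Psi>) \<ge>
    ereal (real (D_const (units_of R) \<Psi>)
      + (\<Sum>P\<in>Spec R. real (T_max (Ind R P) (St_index \<Psi> P)) / real (St_index \<Psi> P)))"
proof -
  interpret cring R
    using assms(1) by (simp add: principal_ideal_ring_def)
  have "\<exists>p\<in>carrier R. I = PIdl\<^bsub>R\<^esub> p" if "ideal I R" for I
  proof -
    have "principalideal I R"
      using assms(1) that by (simp add: principal_ideal_ring_def)
    then obtain p where "p \<in> carrier R" "I = Idl\<^bsub>R\<^esub> {p}"
      using principalideal.generate by blast
    then show ?thesis
      using cgenideal_eq_genideal by auto
  qed
  then interpret finite_pir_autos R \<Psi>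
    using assms(2,3) is_cring
    by (intro finite_pir_autos.intro finite_pir.intro finite_pir_axioms.intro
        finite_pir_autos_axioms.intro)
  show ?thesis
    by (rule I_const_lower_bound)
qed

end
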